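(* Let $M\in\mathbb C^{n\times n}$ and $\varepsilon>0$. Let $$\Delta_{\rm opt}=\operatorname{diag}(\delta_1 I_{r_1},\ldots,\delta_{S'}I_{r_{S'}},\delta_{S'+1}I_{r_{S'+1}},\ldots,\delta_S I_{r_S},\Delta_1,\ldots,\Delta_F),\qquad\|\Delta_{\rm opt}\|_2=1,$$ be a local extremizer of $\Sigma_\varepsilon^{\mathbb B}(M)$. Let $\zeta=|\zeta|e^{\mathbf i\theta}$ be a simple smallest eigenvalue of the matrix $I-\varepsilon M\Delta_{\rm opt}$, with the right and left eigenvectors $x$ and $y$ scaled such that $s=e^{\mathbf i\theta}y^*x>0$. Let $z=M^*y$ and partition $$x=(x_1^{\rm T},\ldots,x_S^{\rm T},x_{S+1}^{\rm T},\ldots,x_{S+F}^{\rm T})^{\rm T},\qquad z=(z_1^{\rm T},\ldots,z_S^{\rm T},z_{S+1}^{\rm T},\ldots,z_{S+F}^{\rm T})^{\rm T}$$ such that the size of the components $x_k,z_k$ equals the size of the $k$-th diagonal block of $\Delta_{\rm opt}$. Assume that $$z_k^*x_k\neq0\quad\forall\,k=1,\ldots,S',$$ $$\operatorname{Re}(z_k^*x_k)\neq0\quad\forall\,k=S'+1,\ldots,S,$$ $$\|z_{S+h}\|_2\cdot\|x_{S+h}\|_2\neq0\quad\forall\,h=1,\ldots,F.$$ Then $$|\delta_k|=1\quad\forall\,k=1,\ldots,S\qquad\text{and}\qquad\|\Delta_h\|_2=1\quad\forall\,h=1,\ldots,F,$$ that is, all blocks of $\Delta_{\rm opt}$ have unit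 $2$-norm.
   Context: Fix integers $0\le S'\le S$, $F\ge0$ and positive integers $r_1,\ldots,r_S,m_1,\ldots,m_F$ with $\sum_{i=1}^S r_i+\sum_{j=1}^F m_j=n$. The mixed complex/real perturbation set is $$\mathbb B=\{\operatorname{diag}(\delta_1 I_{r_1},\ldots,\delta_S I_{r_S},\Delta_1,\ldots,\Delta_F):\ \delta_i\in\mathbb C\ (i\le S'),\ \delta_i\in\mathbb R\ (S'<i\le S),\ \Delta_j\in\mathbb C^{m_j\times m_j}\},$$ where $I_r$ is the $r\times r$ identity matrix and $I$ is the $n\times n$ identity matrix. $\|\cdot\|_2$ is the matrix $2$-norm (Euclidean norm for vectors), ${}^*$ denotes the conjugate transpose, $\Lambda(\cdot)$ the spectrum of a matrix, and $\mathbf i$ the imaginary unit. Define $$\Lambda_\varepsilon^{\mathbb B}(M)=\{\lambda\in\Lambda(\varepsilon M\Delta):\Delta\in\mathbb B,\ \|\Delta\|_2\le1\},\qquad\Sigma_\varepsilon^{\mathbb B}(M)=\{1-\lambda:\lambda\in\Lambda_\varepsilon^{\mathbb B}(M)\}.$$ A smallest eigenvalue of a matrix is an eigenvalue of minimal modulus. A matrix $\Delta\in\mathbb B$ such that $\|\Delta\|_2\le1$ and $I-\varepsilon M\Delta$ has a smallest eigenvalue that locally minimizes the modulus of $\Sigma_\varepsilon^{\mathbb B}(M)$ is called a local extremizer of $\Sigma_\varepsilon^{\mathbb B}(M)$. Right and left eigenvectors $x,y\ne0$ of a matrix $C$ associated with an eigenvalue $\zeta$ satisfy $(C-\zeta I)x=0$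 and $y^*(C-\zeta I)=0$.
   Formalization: The formal theorem additionally assumes ζ ≠ 0 and that ζ itself (not merely some other smallest eigenvalue of equal modulus) locally minimizes the modulus of Σ; without either assumption the claim as stated has counterexamples. *)

theory Defs
  imports
    "Jordan_Normal_Form.Spectral_Radius"
    "Jordan_Normal_Form.Schur_Decomposition"
begin

definition vec_norm2 :: "complex vec \<Rightarrow> real" where
  "vec_norm2 v = sqrt (\<Sum>i<dim_vec v. (cmod (v $ i))\<^sup>2)"

(* The supremum is over the unit ball rather than the unit sphere so that it is
   also meaningful for a matrix without columns. *)
definition mat_norm2 :: "complex mat \<Rightarrow> real" where
  "mat_norm2 A = Sup {vec_norm2 (A *\<^sub>v v) | v. v \<in> carrier_vec (dim_col A) \<and> vec_norm2 v \<le> 1}"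

(* Block sizes are lists: rs = [r_1, ..., r_S] for the repeated scalar blocks, with values
   ds = [delta_1, ..., delta_S], and ms = [m_1, ..., m_F] for the full blocks
   Ds = [Delta_1, ..., Delta_F].  List indices start at 0, so the complex scalars are those
   with index i < S' and the real ones those with S' \<le> i. *)
definition block_data ::
  "nat \<Rightarrow> nat list \<Rightarrow> nat list \<Rightarrow> complex list \<Rightarrow> complex mat list \<Rightarrow> bool" where
  "block_data S' rs ms ds Ds \<longleftrightarrow>
     length ds = length rs \<and> length Ds = length ms \<and>
     (\<forall>i<length rs. S' \<le> i \<longrightarrow> ds ! i \<in> \<real>) \<and>
     (\<forall>j<length ms. Ds ! j \<in> carrier_mat (ms ! j) (ms ! j))"

definition block_diag :: "nat list \<Rightarrow> complex list \<Rightarrow> complex mat list \<Rightarrow> complex mat" where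
  "block_diag rs ds Ds = diag_block_mat (map2 (\<lambda>r d. d \<cdot>\<^sub>m 1\<^sub>m r) rs ds @ Ds)"

definition perturbations :: "nat \<Rightarrow> nat list \<Rightarrow> nat list \<Rightarrow> complex mat set" where
  "perturbations S' rs ms = {block_diag rs ds Ds | ds Ds. block_data S' rs ms ds Ds}"

definition Lambda_eps :: "complex mat set \<Rightarrow> real \<Rightarrow> complex mat \<Rightarrow> complex set" where
  "Lambda_eps B \<epsilon> M =
     (\<Union>\<Delta>\<in>{\<Delta> \<in> B. mat_norm2 \<Delta> \<le> 1}. spectrum (complex_of_real \<epsilon> \<cdot>\<^sub>m (M * \<Delta>)))"

definition Sigma_eps :: "complex mat set \<Rightarrow> real \<Rightarrow> complex mat \<Rightarrow> complex set" where
  "Sigma_eps B \<epsilon> M = {1 - l | l. l \<in> Lambda_eps B \<epsilon> M}"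

definition smallest_eigenvalue :: "complex mat \<Rightarrow> complex \<Rightarrow> bool" where
  "smallest_eigenvalue C \<zeta> \<longleftrightarrow>
     eigenvalue C \<zeta> \<and> (\<forall>\<mu>. eigenvalue C \<mu> \<longrightarrow> cmod \<zeta> \<le> cmod \<mu>)"

(* Local refers to the topology of the complex plane, where the set lives. *)
definition locally_minimizes_modulus :: "complex set \<Rightarrow> complex \<Rightarrow> bool" where
  "locally_minimizes_modulus X \<zeta> \<longleftrightarrow>
     \<zeta> \<in> X \<and> (\<exists>\<rho>>0. \<forall>\<sigma>\<in>X. dist \<sigma> \<zeta> < \<rho> \<longrightarrow> cmod \<zeta> \<le> cmod \<sigma>)"

definition shifted :: "real \<Rightarrow> complex mat \<Rightarrow> complex mat \<Rightarrow> complex mat" where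
  "shifted \<epsilon> M \<Delta> = 1\<^sub>m (dim_row M) - complex_of_real \<epsilon> \<cdot>\<^sub>m (M * \<Delta>)"

definition local_extremizer ::
  "complex mat set \<Rightarrow> real \<Rightarrow> complex mat \<Rightarrow> complex mat \<Rightarrow> bool" where
  "local_extremizer B \<epsilon> M \<Delta> \<longleftrightarrow>
     \<Delta> \<in> B \<and> mat_norm2 \<Delta> \<le> 1 \<and>
     (\<exists>\<zeta>. smallest_eigenvalue (shifted \<epsilon> M \<Delta>) \<zeta> \<and>
          locally_minimizes_modulus (Sigma_eps B \<epsilon> M) \<zeta>)"

definition simple_eigenvalue :: "complex mat \<Rightarrow> complex \<Rightarrow> bool" where
  "simple_eigenvalue C \<zeta> \<longleftrightarrow> order \<zeta> (char_poly C) = 1"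

definition left_eigenvector :: "complex mat \<Rightarrow> complex vec \<Rightarrow> complex \<Rightarrow> bool" where
  "left_eigenvector C y \<zeta> \<longleftrightarrow>
     y \<in> carrier_vec (dim_row C) \<and> y \<noteq> 0\<^sub>v (dim_row C) \<and>
     mat_of_row (conjugate y) * (C - \<zeta> \<cdot>\<^sub>m 1\<^sub>m (dim_row C)) = 0\<^sub>m 1 (dim_col C)"

definition vec_block :: "nat list \<Rightarrow> nat \<Rightarrow> complex vec \<Rightarrow> complex vec" where
  "vec_block sizes k v = vec (sizes ! k) (\<lambda>i. v $ (sum_list (take k sizes) + i))"

end

theory Submission
  imports Defs "HOL-Analysis.L2_Norm"
begin

text \<open>
  The claim is a first-order optimality condition. Replace one diagonal block $A_k$ of
  $\Delta_{opt}$ by $A_k + tE_k$. The simple eigenvalue $\zeta$ of $I - \varepsilon M\Delta_{opt}$ then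
  moves with velocity $-\varepsilon\, y^* M E x/(y^* x)$, where $E$ is zero outside block $k$, and
  $y^* M E x = z_k^* E_k x_k$. By the scaling of $x$ and $y$ the modulus of the eigenvalue has the
  derivative $-(\varepsilon/s)\,\mathrm{Re}(z_k^* E_k x_k)$. If the block has norm less than one, every
  direction $E_k$ of the right structure is feasible for small $t > 0$, because the norm of a
  block-diagonal matrix is the maximum of the norms of its blocks
  (\<open>mat_norm2_diag_block_mat_le_iff\<close>). Local minimality therefore forces
  $\mathrm{Re}(z_k^* E_k x_k) \le 0$ for all these directions (\<open>block_first_order_optimality\<close>). This
  fails for $E_k = \overline{z_k^* x_k}\, I$ in a complex scalar block, for
  $E_k = \mathrm{Re}(z_k^* x_k)\, I$ in a real scalar block, and for $E_k = z_k x_k^*$ in a full block,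
  since the assumptions on $x_k$ and $z_k$ make the real part positive. So every block has norm one.

  The analytic core is the perturbation formula for a simple eigenvalue,
  \<open>simple_eigenvalue_first_order\<close>. It rests on an elementary root estimate: a complex polynomial $p$ of
  degree $n$ has a root within distance $n|p(w)|/|p'(w)|$ of $w$ if $p'(w) \neq 0$. Applied to the characteristic
  polynomial of the perturbed matrix at the predicted eigenvalue $w$, this reduces the formula to a
  determinant being $o(t)$ there and to the continuity of $p'$.
\<close>

section \<open>First-order perturbation of a simple eigenvalue\<close>

lemma smult_mat_mult_vec:
  fixes A :: "'a :: comm_ring_1 mat"
  assumes "A \<in> carrier_mat m n" and "v \<in> carrier_vec n"
  shows "(c \<cdot>\<^sub>m A) *\<^sub>v v = c \<cdot>\<^sub>v (A *\<^sub>v v)"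
  using assms by (intro eq_vecI) (auto simp: scalar_prod_def sum_distrib_left mult.assoc)

text \<open>Away from the roots $p'(z)/p(z) = \sum_i 1/(z-a_i)$, so this is a bound on a sum of
  reciprocals. The form without divisions also covers the roots, and the product rule proves it
  one factor at a time.\<close>

lemma pderiv_prod_linear_bound:
  fixes z :: "'a :: real_normed_field"
  assumes "0 \<le> r" and "\<forall>a\<in>set as. r \<le> norm (z - a)"
  shows "norm (poly (pderiv (\<Prod>a\<leftarrow>as. [:- a, 1:])) z) * r
    \<le> of_nat (length as) * norm (poly (\<Prod>a\<leftarrow>as. [:- a, 1:]) z)"
  using assms
proof (induction as)
  case Nil
  then show ?case by simp
next
  case (Cons a as)
  define q where "q = (\<Prod>a\<leftarrow>as. [:- a, 1:])"
  have IH: "norm (poly (pderiv q) z) * r \<le> of_nat (length as) * norm (poly q z)"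
    using Cons by (simp add: q_def)
  have ra: "r \<le> norm (z - a)" using Cons.prems by simp
  have eq0: "poly ([:- a, 1:] * q) z = (z - a) * poly q z"
    by (simp add: algebra_simps)
  have eq: "poly (pderiv ([:- a, 1:] * q)) z = poly q z + (z - a) * poly (pderiv q) z"
    unfolding pderiv_mult by (simp add: pderiv_pCons algebra_simps)
  have "norm (poly (pderiv ([:- a, 1:] * q)) z) * r
      \<le> (norm (poly q z) + norm (z - a) * norm (poly (pderiv q) z)) * r"
    unfolding eq using \<open>0 \<le> r\<close>
    by (intro mult_right_mono norm_triangle_le) (simp_all add: norm_mult)
  also have "\<dots> = norm (poly q z) * r + norm (z - a) * (norm (poly (pderiv q) z) * r)"
    by (simp add: algebra_simps)
  also have "\<dots> \<le> norm (poly q z) * norm (z - a)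
      + norm (z - a) * (of_nat (length as) * norm (poly q z))"
    by (intro add_mono mult_left_mono IH ra) auto
  also have "\<dots> = of_nat (length (a # as)) * norm (poly ([:- a, 1:] * q) z)"
    unfolding eq0 norm_mult by (simp add: algebra_simps)
  finally show ?case by (simp add: q_def)
qed

text \<open>A quantitative substitute for Rouche's theorem: where the characteristic polynomial is
  small and its derivative is not, an eigenvalue must be near. Choosing the root nearest to
  \<open>z\<close> makes its distance the \<open>r\<close> of the preceding bound.\<close>

lemma char_poly_root_near:
  fixes A :: "complex mat"
  assumes A: "A \<in> carrier_mat n n" and n: "0 < n"
  shows "\<exists>\<mu>. eigenvalue A \<mu> \<and>
    cmod (poly (pderiv (char_poly A)) z) * cmod (z - \<mu>) \<le> real n * cmod (poly (char_poly A) z)"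
proof -
  obtain as where as: "char_poly A = (\<Prod>a\<leftarrow>as. [:- a, 1:])" "length as = n"
    using char_poly_factorized[OF A] by blast
  have ne: "set as \<noteq> {}" using as n by auto
  define \<mu> where "\<mu> = arg_min_on (\<lambda>a. cmod (z - a)) (set as)"
  have \<mu>: "\<mu> \<in> set as" "\<forall>a\<in>set as. cmod (z - \<mu>) \<le> cmod (z - a)"
    using ne unfolding \<mu>_def by (auto intro: arg_min_if_finite arg_min_least)
  have "poly (char_poly A) \<mu> = 0"
    unfolding as poly_prod_list prod_list_zero_iff using \<mu>(1) by (auto intro!: image_eqI[of _ _ \<mu>])
  then show ?thesis
    using pderiv_prod_linear_bound[of "cmod (z - \<mu>)" as z] \<mu>(2) as
    by (auto simp: eigenvalue_root_char_poly[OF A])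
qed

lemma tendsto_det:
  fixes L :: "'a :: real_normed_field mat"
  assumes A: "\<And>t. A t \<in> carrier_mat n n" and L: "L \<in> carrier_mat n n"
    and lim: "\<And>i j. i < n \<Longrightarrow> j < n \<Longrightarrow> ((\<lambda>t. A t $$ (i, j)) \<longlongrightarrow> L $$ (i, j)) G"
  shows "((\<lambda>t. det (A t)) \<longlongrightarrow> det L) G"
proof -
  have "((\<lambda>t. signof p * (\<Prod>i = 0..<n. A t $$ (i, p i)))
      \<longlongrightarrow> signof p * (\<Prod>i = 0..<n. L $$ (i, p i))) G" if "p permutes {0..<n}" for p
    by (intro tendsto_intros lim) (use that in \<open>auto dest: permutes_in_image\<close>)
  then show ?thesis
    unfolding det_def'[OF A] det_def'[OF L] by (intro tendsto_sum) auto
qed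

lemma tendsto_poly_char_poly:
  fixes L :: "complex mat"
  assumes A: "\<And>t. A t \<in> carrier_mat n n" and L: "L \<in> carrier_mat n n"
    and lim: "\<And>i j. i < n \<Longrightarrow> j < n \<Longrightarrow> ((\<lambda>t. A t $$ (i, j)) \<longlongrightarrow> L $$ (i, j)) G"
    and w: "(w \<longlongrightarrow> \<zeta>) G"
  shows "((\<lambda>t. poly (char_poly (A t)) (w t)) \<longlongrightarrow> poly (char_poly L) \<zeta>) G"
proof -
  have "((\<lambda>t. det (- char_matrix (A t) (w t))) \<longlongrightarrow> det (- char_matrix L \<zeta>)) G"
  proof (rule tendsto_det)
    fix i j assume ij: "i < n" "j < n"
    have "((\<lambda>t. - (A t $$ (i, j) + - w t * (if i = j then 1 else 0)))
        \<longlongrightarrow> - (L $$ (i, j) + - \<zeta> * (if i = j then 1 else 0))) G"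
      by (intro tendsto_intros lim w ij)
    moreover have "dim_row (A t) = n" "dim_col (A t) = n" for t using A[of t] by auto
    ultimately show "((\<lambda>t. (- char_matrix (A t) (w t)) $$ (i, j)) \<longlongrightarrow> (- char_matrix L \<zeta>) $$ (i, j)) G"
      using ij L by (simp add: char_matrix_def)
  qed (use A L in auto)
  then show ?thesis by (simp add: char_poly_matrix[OF A] char_poly_matrix[OF L])
qed

lemma tendsto_poly_pderiv_char_poly:
  fixes L :: "complex mat"
  assumes A: "\<And>t. A t \<in> carrier_mat n n" and L: "L \<in> carrier_mat n n"
    and lim: "\<And>i j. i < n \<Longrightarrow> j < n \<Longrightarrow> ((\<lambda>t. A t $$ (i, j)) \<longlongrightarrow> L $$ (i, j)) G"
    and w: "(w \<longlongrightarrow> \<zeta>) G"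
  shows "((\<lambda>t. poly (pderiv (char_poly (A t))) (w t)) \<longlongrightarrow> poly (pderiv (char_poly L)) \<zeta>) G"
proof -
  have dim: "dim_row (A t) = n" "dim_col (A t) = n" for t using A[of t] by auto
  have "((\<lambda>t. poly (char_poly (mat_delete (A t) i i)) (w t))
      \<longlongrightarrow> poly (char_poly (mat_delete L i i)) \<zeta>) G" if "i < n" for i
    by (rule tendsto_poly_char_poly[where n = "n - 1"])
      (use that L w in \<open>auto simp: mat_delete_def dim intro!: lim mat_carrier\<close>)
  then show ?thesis
    unfolding pderiv_char_poly[OF A] pderiv_char_poly[OF L] poly_sum by (intro tendsto_sum) auto
qed

lemma simple_eigenvalue_pderiv:
  assumes C: "C \<in> carrier_mat n n" and simple: "simple_eigenvalue C \<zeta>"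
  shows "poly (pderiv (char_poly C)) \<zeta> \<noteq> 0"
proof -
  have o: "order \<zeta> (char_poly C) = 1" using simple by (simp add: simple_eigenvalue_def)
  have ne: "pderiv (char_poly C) \<noteq> 0"
  proof
    assume "pderiv (char_poly C) = 0"
    then obtain a where a: "char_poly C = [:a:]"
      by (metis pderiv_eq_0_iff degree_eq_zeroE)
    moreover have "a \<noteq> 0" using a degree_monic_char_poly[OF C] by auto
    ultimately show False using o by (auto simp: order_0I)
  qed
  then have "order \<zeta> (char_poly C) = Suc (order \<zeta> (pderiv (char_poly C)))"
    using o by (intro order_pderiv) (auto simp: order_root)
  then show ?thesis using o ne by (simp add: order_root)
qed

text \<open>The candidate \<open>w t = \<zeta> + t * c\<close>, with \<open>c\<close> the expected derivative, turns out to satisfy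
  \<open>det (C + t E - w t) = o(t)\<close>, while the derivative of the characteristic polynomial at \<open>w t\<close>
  tends to its nonzero value at the simple root \<open>\<zeta>\<close>. Hence an eigenvalue lies within \<open>o(t)\<close> of
  \<open>w t\<close>.

  The estimate of the determinant has a factor \<open>t\<close> because the right eigenvector \<open>x\<close> is mapped to
  \<open>t g\<close> with \<open>g = (E - c) x\<close>: by Cramer's rule the determinant is, up to a constant, \<open>t\<close> times the
  determinant with column \<open>k\<close> replaced by \<open>g\<close>. That second determinant vanishes in the limit,
  since \<open>c\<close> is chosen so that \<open>y\<close> is orthogonal to \<open>g\<close>, and \<open>y\<close> is orthogonal to the remaining
  columns as a left eigenvector.\<close>

lemma simple_eigenvalue_first_order:
  fixes C E :: "complex mat"
  assumes C: "C \<in> carrier_mat n n" and E: "E \<in> carrier_mat n n"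
    and simple: "simple_eigenvalue C \<zeta>" and x: "eigenvector C x \<zeta>"
    and y: "y \<in> carrier_vec n" "y \<noteq> 0\<^sub>v n"
    and left: "\<And>v. v \<in> carrier_vec n \<Longrightarrow> (C *\<^sub>v v) \<bullet>c y = \<zeta> * (v \<bullet>c y)"
    and xy: "x \<bullet>c y \<noteq> 0"
  shows "\<exists>\<mu>. (\<forall>t. eigenvalue (C + complex_of_real t \<cdot>\<^sub>m E) (\<mu> t)) \<and>
    ((\<lambda>t. (\<mu> t - \<zeta>) / complex_of_real t) \<longlongrightarrow> ((E *\<^sub>v x) \<bullet>c y) / (x \<bullet>c y)) (at 0)"
proof -
  have xc: "x \<in> carrier_vec n" and x0: "x \<noteq> 0\<^sub>v n" and Cx: "C *\<^sub>v x = \<zeta> \<cdot>\<^sub>v x"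
    using x C by (auto simp: eigenvector_def)
  obtain k where k: "k < n" "x $ k \<noteq> 0"
    using x0 xc by (metis carrier_vecD eq_vecI index_zero_vec(1) index_zero_vec(2))
  define c where "c = ((E *\<^sub>v x) \<bullet>c y) / (x \<bullet>c y)"
  define A where "A t = C + complex_of_real t \<cdot>\<^sub>m E" for t
  define w where "w t = \<zeta> + complex_of_real t * c" for t
  define N where "N t = char_matrix (A t) (w t)" for t
  define g where "g = E *\<^sub>v x - c \<cdot>\<^sub>v x"
  have A: "A t \<in> carrier_mat n n" for t using C E by (simp add: A_def)
  have N: "N t \<in> carrier_mat n n" for t using A by (simp add: N_def)
  have g: "g \<in> carrier_vec n" using E xc by (simp add: g_def)
  have dims: "dim_row C = n" "dim_col C = n" "dim_row E = n" "dim_col E = n" "dim_vec x = n"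
    using C E xc by auto
  have A0: "A 0 = C" by (rule eq_matI) (auto simp: A_def dims)
  have limA: "((\<lambda>t. A t $$ (i, j)) \<longlongrightarrow> C $$ (i, j)) (at 0)" if "i < n" "j < n" for i j
  proof -
    have "((\<lambda>t. C $$ (i, j) + complex_of_real t * E $$ (i, j)) \<longlongrightarrow> C $$ (i, j) + complex_of_real 0 * E $$ (i, j)) (at 0)"
      by (intro tendsto_intros)
    then show ?thesis using that by (simp add: A_def dims)
  qed
  have limw: "(w \<longlongrightarrow> \<zeta>) (at 0)"
  proof -
    have "(w \<longlongrightarrow> \<zeta> + complex_of_real 0 * c) (at 0)"
      unfolding w_def by (intro tendsto_intros)
    then show ?thesis by simp
  qed
  have gy: "g \<bullet>c y = 0"
  proof -
    have "g \<bullet>c y = (E *\<^sub>v x) \<bullet>c y - c * (x \<bullet>c y)"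
      unfolding g_def using E xc y(1)
      by (subst minus_scalar_prod_distrib[of _ n]) auto
    then show ?thesis using xy by (simp add: c_def)
  qed
  have Nx: "N t *\<^sub>v x = complex_of_real t \<cdot>\<^sub>v g" for t
  proof -
    have "N t *\<^sub>v x = (C *\<^sub>v x + complex_of_real t \<cdot>\<^sub>v (E *\<^sub>v x)) + (- w t) \<cdot>\<^sub>v x"
      unfolding N_def char_matrix_def A_def using C E xc dims
      by (simp add: add_mult_distrib_mat_vec[of _ n n] smult_mat_mult_vec[of _ n n]
          assoc_add_vec[of _ n])
    also have "\<dots> = complex_of_real t \<cdot>\<^sub>v g"
      unfolding Cx g_def w_def by (rule eq_vecI) (use dims in \<open>auto simp: algebra_simps\<close>)
    finally show ?thesis .
  qed
  define R where "R t = replace_col (N t) g k" for t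
  have R: "R t \<in> carrier_mat n n" for t using N[of t] by (simp add: R_def replace_col_def)
  \<comment> \<open>Cramer's rule for the vector \<open>x / t\<close>, whose image is exactly \<open>g\<close>.\<close>
  have detR: "det (N t) / complex_of_real t = det (R t) / x $ k" if "t \<noteq> 0" for t
  proof -
    have "N t *\<^sub>v ((1 / complex_of_real t) \<cdot>\<^sub>v x) = g"
      using that g by (simp add: mult_mat_vec[OF N xc] Nx smult_smult_assoc)
    then have "det (R t) = (1 / complex_of_real t) * x $ k * det (N t)"
      using cramer_lemma_mat[OF N, of "(1 / complex_of_real t) \<cdot>\<^sub>v x" k t] xc k
      by (simp add: R_def)
    then show ?thesis using k by simp
  qed
  \<comment> \<open>At \<open>t = 0\<close> every column is orthogonal to \<open>y\<close>, so the rows are linearly dependent.\<close>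
  have detR0: "det (R 0) = 0"
  proof -
    have col: "col (R 0) j \<bullet>c y = 0" if j: "j < n" for j
    proof (cases "j = k")
      case True
      have "col (R 0) k = g" 
        by (rule eq_vecI) (use g k N[of 0] in \<open>auto simp: R_def replace_col_def\<close>)
      then show ?thesis using gy True by simp
    next
      case False
      have "col (R 0) j = N 0 *\<^sub>v unit_vec n j"
        using False j N[of 0] by (intro eq_vecI) (auto simp: R_def replace_col_def)
      also have "\<dots> = C *\<^sub>v unit_vec n j + (- \<zeta>) \<cdot>\<^sub>v unit_vec n j"
        unfolding N_def char_matrix_def A0 w_def using C dims
        by (simp add: add_mult_distrib_mat_vec[of _ n n] smult_mat_mult_vec[of _ n n])
      finally show ?thesis using C y(1)
        by (simp add: add_scalar_prod_distrib[of _ n] left)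
    qed
    have "transpose_mat (R 0) *\<^sub>v conjugate y = 0\<^sub>v n"
      by (rule eq_vecI) (use col R[of 0] in auto)
    moreover have "conjugate y \<noteq> 0\<^sub>v n" using y by (metis conjugate_zero_iff_vec)
    ultimately have "det (transpose_mat (R 0)) = 0"
      using y R[of 0] by (subst det_0_iff_vec_prod_zero_field[of _ n]) (auto intro!: exI[of _ "conjugate y"])
    then show ?thesis using det_transpose[OF R] by simp
  qed
  have limR: "((\<lambda>t. det (R t)) \<longlongrightarrow> 0) (at 0)"
  proof -
    have "((\<lambda>t. det (R t)) \<longlongrightarrow> det (R 0)) (at 0)"
    proof (rule tendsto_det)
      fix i j assume ij: "i < n" "j < n"
      have "((\<lambda>t. A t $$ (i, j) - w t * (if i = j then 1 else 0))
          \<longlongrightarrow> C $$ (i, j) - \<zeta> * (if i = j then 1 else 0)) (at 0)"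
        by (intro tendsto_intros limA limw ij)
      moreover have "dim_row (A t) = n" "dim_col (A t) = n" for t using A[of t] by auto
      moreover have "w 0 = \<zeta>" "A 0 $$ (i, j) = C $$ (i, j)" by (simp_all add: w_def A0)
      ultimately show "((\<lambda>t. R t $$ (i, j)) \<longlongrightarrow> R 0 $$ (i, j)) (at 0)"
        using ij by (auto simp: R_def replace_col_def N_def char_matrix_def)
    qed (use R in auto)
    then show ?thesis by (simp add: detR0)
  qed
  have "\<forall>t. \<exists>m. eigenvalue (A t) m \<and> cmod (poly (pderiv (char_poly (A t))) (w t)) * cmod (w t - m)
      \<le> real n * cmod (poly (char_poly (A t)) (w t))"
    using char_poly_root_near[OF A] k by auto
  then obtain \<mu> where ev: "\<And>t. eigenvalue (A t) (\<mu> t)"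
    and near: "\<And>t. cmod (poly (pderiv (char_poly (A t))) (w t)) * cmod (w t - \<mu> t)
      \<le> real n * cmod (poly (char_poly (A t)) (w t))"
    by metis
  define d where "d t = poly (pderiv (char_poly (A t))) (w t)" for t
  have d: "(d \<longlongrightarrow> poly (pderiv (char_poly C)) \<zeta>) (at 0)"
    unfolding d_def by (rule tendsto_poly_pderiv_char_poly[OF A C limA limw])
  have d0: "poly (pderiv (char_poly C)) \<zeta> \<noteq> 0" using C simple by (rule simple_eigenvalue_pderiv)
  \<comment> \<open>The characteristic polynomial is \<open>det (z - A)\<close>, which differs from \<open>det (A - z)\<close> by a sign.\<close>
  have pN: "cmod (poly (char_poly (A t)) (w t)) = cmod (det (N t))" for t
  proof -
    have "- N t = - 1 \<cdot>\<^sub>m N t" by (rule eq_matI) auto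
    then show ?thesis
      by (simp add: char_poly_matrix[OF A] norm_mult norm_power flip: N_def)
  qed
  have bound: "\<forall>\<^sub>F t in at 0. norm ((\<mu> t - w t) / complex_of_real t)
      \<le> real n * cmod (det (R t) / x $ k) / cmod (d t)"
  proof -
    have "\<forall>\<^sub>F t in at 0. d t \<noteq> 0" using d d0 by (rule tendsto_imp_eventually_ne)
    moreover have "\<forall>\<^sub>F t in at (0::real). t \<noteq> 0" by (simp add: eventually_at_filter)
    ultimately show ?thesis
    proof eventually_elim
      case (elim t)
      have "cmod (d t) * cmod (\<mu> t - w t) \<le> real n * cmod (det (N t))"
        using near[of t] by (simp add: pN d_def norm_minus_commute)
      then have "cmod (d t) * cmod (\<mu> t - w t) / \<bar>t\<bar> \<le> real n * cmod (det (N t)) / \<bar>t\<bar>"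
        by (rule divide_right_mono) simp
      also have "\<dots> = real n * cmod (det (R t) / x $ k)"
        using detR[OF elim(2)] by (metis norm_divide norm_of_real times_divide_eq_right)
      finally have "cmod (d t) * norm ((\<mu> t - w t) / complex_of_real t)
          \<le> real n * cmod (det (R t) / x $ k)"
        by (simp add: norm_divide)
      then show ?case using elim(1) by (subst pos_le_divide_eq) (simp_all add: mult.commute)
    qed
  qed
  have "((\<lambda>t. real n * cmod (det (R t) / x $ k) / cmod (d t))
      \<longlongrightarrow> real n * cmod (0 / x $ k) / cmod (poly (pderiv (char_poly C)) \<zeta>)) (at 0)"
    by (intro tendsto_intros limR d) (use k d0 in auto)
  then have "((\<lambda>t. real n * cmod (det (R t) / x $ k) / cmod (d t)) \<longlongrightarrow> 0) (at 0)"
    by simp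
  then have "((\<lambda>t. (\<mu> t - w t) / complex_of_real t) \<longlongrightarrow> 0) (at 0)"
  proof (rule tendsto_0_le[where K = 1])
    show "\<forall>\<^sub>F t in at 0. norm ((\<mu> t - w t) / complex_of_real t)
        \<le> norm (real n * cmod (det (R t) / x $ k) / cmod (d t)) * 1"
      using bound by eventually_elim (erule order_trans, simp)
  qed
  then have "((\<lambda>t. (\<mu> t - w t) / complex_of_real t + c) \<longlongrightarrow> 0 + c) (at 0)"
    by (intro tendsto_intros)
  moreover have "\<forall>\<^sub>F t in at 0. (\<mu> t - w t) / complex_of_real t + c = (\<mu> t - \<zeta>) / complex_of_real t"
    by (auto simp: eventually_at_filter w_def field_simps)
  ultimately have "((\<lambda>t. (\<mu> t - \<zeta>) / complex_of_real t) \<longlongrightarrow> c) (at 0)"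
    using Lim_transform_eventually by fastforce
  then show ?thesis using ev unfolding A_def c_def by blast
qed

lemma left_eigenvector_cscalar_prod:
  assumes C: "C \<in> carrier_mat n n" and y: "left_eigenvector C y \<zeta>" and v: "v \<in> carrier_vec n"
  shows "(C *\<^sub>v v) \<bullet>c y = \<zeta> * (v \<bullet>c y)"
proof -
  define K where "K = C - \<zeta> \<cdot>\<^sub>m 1\<^sub>m n"
  have yc: "y \<in> carrier_vec n" and 0: "mat_of_row (conjugate y) * K = 0\<^sub>m 1 n"
    using y C by (auto simp: left_eigenvector_def K_def)
  have K: "K \<in> carrier_mat n n" unfolding K_def by (intro minus_carrier_mat) auto
  have "mat_of_row (conjugate y) *\<^sub>v (K *\<^sub>v v) = 0\<^sub>m 1 n *\<^sub>v v"
    unfolding 0[symmetric] using K yc v by (subst assoc_mult_mat_vec[of _ 1 n _ n]) auto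
  from arg_cong[OF this, of "\<lambda>w. w $ 0"] have "conjugate y \<bullet> (K *\<^sub>v v) = 0"
    using v by simp
  then have "(K *\<^sub>v v) \<bullet>c y = 0"
    using K v yc by (subst comm_scalar_prod[of _ n]) auto
  moreover have "K *\<^sub>v v = C *\<^sub>v v - \<zeta> \<cdot>\<^sub>v v"
    unfolding K_def using C v
    by (simp add: minus_mult_distrib_mat_vec[of _ n n] smult_mat_mult_vec[of _ n n])
  ultimately show ?thesis
    using C v yc by (simp add: minus_scalar_prod_distrib[of _ n])
qed

lemma cscalar_prod_adjoint:
  fixes M :: "complex mat"
  assumes M: "M \<in> carrier_mat m n" and v: "v \<in> carrier_vec n" and y: "y \<in> carrier_vec m"
  shows "(M *\<^sub>v v) \<bullet>c y = v \<bullet>c (mat_adjoint M *\<^sub>v y)"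
proof -
  have "conjugate (mat_adjoint M *\<^sub>v y) = transpose_mat M *\<^sub>v conjugate y"
  proof (rule eq_vecI)
    fix i assume "i < dim_vec (transpose_mat M *\<^sub>v conjugate y)"
    then have i: "i < n" using M by simp
    have "row (mat_adjoint M) i = conjugate (col M i)"
      using M i unfolding mat_adjoint_def by (subst mat_of_rows_row) auto
    moreover have "dim_row (mat_adjoint M) = n" using M by (simp add: mat_adjoint_def)
    moreover have "conjugate (conjugate (col M i) \<bullet> y) = col M i \<bullet>c y"
      using M y by (intro conjugate_conjugate_sprod[of _ m]) auto
    ultimately show "conjugate (mat_adjoint M *\<^sub>v y) $ i = (transpose_mat M *\<^sub>v conjugate y) $ i"
      using M i by simp
  qed (use M in \<open>simp add: mat_adjoint_def\<close>)
  then have "v \<bullet>c (mat_adjoint M *\<^sub>v y) = (transpose_mat M *\<^sub>v conjugate y) \<bullet> v"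
    using M v y by (simp add: comm_scalar_prod[of _ n])
  also have "\<dots> = conjugate y \<bullet> (M *\<^sub>v v)"
    using transpose_vec_mult_scalar[OF M v, of "conjugate y"] y by simp
  also have "\<dots> = (M *\<^sub>v v) \<bullet>c y"
    using M v y by (intro comm_scalar_prod[of _ m]) auto
  finally show ?thesis by simp
qed

section \<open>Euclidean norm and matrix 2-norm\<close>

lemma vec_norm2_L2_set: "vec_norm2 v = L2_set (\<lambda>i. cmod (v $ i)) {..<dim_vec v}"
  by (simp add: vec_norm2_def L2_set_def)

lemma vec_norm2_nonneg [simp]: "0 \<le> vec_norm2 v"
  by (simp add: vec_norm2_L2_set)

lemma cscalar_prod_self: "v \<bullet>c v = complex_of_real ((vec_norm2 v)\<^sup>2)"
  by (simp add: scalar_prod_def vec_norm2_def sum_nonneg complex_norm_square lessThan_atLeast0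
      flip: of_real_power)

lemma vec_norm2_triangle:
  assumes "dim_vec v = dim_vec w"
  shows "vec_norm2 (v + w) \<le> vec_norm2 v + vec_norm2 w"
proof -
  have "vec_norm2 (v + w) \<le> L2_set (\<lambda>i. cmod (v $ i) + cmod (w $ i)) {..<dim_vec w}"
    unfolding vec_norm2_L2_set using assms by (auto intro!: L2_set_mono norm_triangle_ineq)
  also have "\<dots> \<le> vec_norm2 v + vec_norm2 w"
    unfolding vec_norm2_L2_set using L2_set_triangle_ineq assms by metis
  finally show ?thesis .
qed

lemma vec_norm2_smult: "vec_norm2 (c \<cdot>\<^sub>v v) = cmod c * vec_norm2 v"
  unfolding vec_norm2_L2_set by (subst L2_set_right_distrib) (auto simp: norm_mult intro!: L2_set_cong)

lemma vec_norm2_eq_0_iff: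
  assumes "v \<in> carrier_vec n"
  shows "vec_norm2 v = 0 \<longleftrightarrow> v = 0\<^sub>v n"
  using assms by (auto simp: vec_norm2_L2_set L2_set_eq_0_iff intro!: eq_vecI)

lemma vec_norm2_append_sq: "(vec_norm2 (v @\<^sub>v w))\<^sup>2 = (vec_norm2 v)\<^sup>2 + (vec_norm2 w)\<^sup>2"
proof -
  have "complex_of_real ((vec_norm2 (v @\<^sub>v w))\<^sup>2)
      = (v @\<^sub>v w) \<bullet> (conjugate v @\<^sub>v conjugate w)"
    unfolding cscalar_prod_self[symmetric]
    by (rule arg_cong[where f = "scalar_prod (v @\<^sub>v w)"], rule eq_vecI) auto
  also have "\<dots> = v \<bullet>c v + w \<bullet>c w" by (rule scalar_prod_append[of _ "dim_vec v" _ "dim_vec w"]) auto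
  also have "\<dots> = complex_of_real ((vec_norm2 v)\<^sup>2 + (vec_norm2 w)\<^sup>2)"
    by (simp add: cscalar_prod_self)
  finally show ?thesis unfolding of_real_eq_iff .
qed

text \<open>A crude bound, needed because a supremum of reals is only meaningful for a bounded set.\<close>

lemma vec_norm2_mult_mat_vec_bound:
  assumes A: "A \<in> carrier_mat m n" and v: "v \<in> carrier_vec n"
  shows "vec_norm2 (A *\<^sub>v v) \<le> (\<Sum>i<m. \<Sum>j<n. cmod (A $$ (i, j))) * vec_norm2 v"
proof -
  have "vec_norm2 (A *\<^sub>v v) \<le> (\<Sum>i<m. cmod ((A *\<^sub>v v) $ i))"
    unfolding vec_norm2_L2_set using A by (auto intro: order_trans[OF L2_set_le_sum])
  also have "\<dots> \<le> (\<Sum>i<m. \<Sum>j<n. cmod (A $$ (i, j)) * vec_norm2 v)"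
  proof (rule sum_mono)
    fix i assume i: "i \<in> {..<m}"
    have "(A *\<^sub>v v) $ i = (\<Sum>j<n. A $$ (i, j) * v $ j)"
      using i A v by (simp add: scalar_prod_def lessThan_atLeast0)
    also have "cmod \<dots> \<le> (\<Sum>j<n. cmod (A $$ (i, j)) * cmod (v $ j))"
      by (rule order_trans[OF norm_sum]) (simp add: norm_mult)
    also have "\<dots> \<le> (\<Sum>j<n. cmod (A $$ (i, j)) * vec_norm2 v)"
      unfolding vec_norm2_L2_set using v
      by (intro sum_mono mult_left_mono) (auto intro: member_le_L2_set)
    finally show "cmod ((A *\<^sub>v v) $ i) \<le> (\<Sum>j<n. cmod (A $$ (i, j)) * vec_norm2 v)" .
  qed
  also have "\<dots> = (\<Sum>i<m. \<Sum>j<n. cmod (A $$ (i, j))) * vec_norm2 v"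
    by (simp add: sum_distrib_right)
  finally show ?thesis .
qed

lemma bdd_above_mat_norm2:
  "bdd_above {vec_norm2 (A *\<^sub>v v) | v. v \<in> carrier_vec (dim_col A) \<and> vec_norm2 v \<le> 1}"
proof -
  define K where "K = (\<Sum>i<dim_row A. \<Sum>j<dim_col A. cmod (A $$ (i, j)))"
  have "vec_norm2 (A *\<^sub>v v) \<le> K" if "v \<in> carrier_vec (dim_col A)" "vec_norm2 v \<le> 1" for v
  proof -
    have "vec_norm2 (A *\<^sub>v v) \<le> K * vec_norm2 v"
      unfolding K_def using that(1) by (intro vec_norm2_mult_mat_vec_bound) auto
    also have "\<dots> \<le> K * 1" unfolding K_def by (intro mult_left_mono that sum_nonneg) auto
    finally show ?thesis by simp
  qed
  then show ?thesis by (intro bdd_aboveI[where M = K]) auto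
qed

lemma vec_norm2_mult_mat_vec_le:
  assumes A: "A \<in> carrier_mat m n" and v: "v \<in> carrier_vec n"
  shows "vec_norm2 (A *\<^sub>v v) \<le> mat_norm2 A * vec_norm2 v"
proof (cases "v = 0\<^sub>v n")
  case True
  have "A *\<^sub>v 0\<^sub>v n = 0\<^sub>v m" using A by (intro eq_vecI) auto
  then show ?thesis using True
    using vec_norm2_eq_0_iff[of "0\<^sub>v n" n] vec_norm2_eq_0_iff[of "0\<^sub>v m" m] by simp
next
  case False
  define r where "r = vec_norm2 v"
  have r: "0 < r" using False v vec_norm2_eq_0_iff[OF v] by (simp add: r_def order_less_le)
  define u where "u = complex_of_real (1 / r) \<cdot>\<^sub>v v"
  have "vec_norm2 u = 1" using r by (simp add: u_def vec_norm2_smult norm_divide flip: r_def)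
  then have "vec_norm2 (A *\<^sub>v u) \<le> mat_norm2 A"
    unfolding mat_norm2_def using A v
    by (intro cSup_upper bdd_above_mat_norm2) (auto simp: u_def)
  then show ?thesis
    using r by (simp add: u_def mult_mat_vec[OF A v] vec_norm2_smult norm_divide field_simps flip: r_def)
qed

text \<open>The form in which the norm is used from here on: the supremum is replaced by a statement about
  single vectors, which can be tested block by block.\<close>

lemma mat_norm2_le_iff:
  assumes A: "A \<in> carrier_mat m n" and c: "0 \<le> c"
  shows "mat_norm2 A \<le> c \<longleftrightarrow> (\<forall>v\<in>carrier_vec n. vec_norm2 (A *\<^sub>v v) \<le> c * vec_norm2 v)"
proof
  assume le: "mat_norm2 A \<le> c"
  show "\<forall>v\<in>carrier_vec n. vec_norm2 (A *\<^sub>v v) \<le> c * vec_norm2 v"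
    using vec_norm2_mult_mat_vec_le[OF A] le
    by (meson mult_right_mono order_trans vec_norm2_nonneg)
next
  assume *: "\<forall>v\<in>carrier_vec n. vec_norm2 (A *\<^sub>v v) \<le> c * vec_norm2 v"
  show "mat_norm2 A \<le> c"
    unfolding mat_norm2_def
  proof (rule cSup_least)
    show "{vec_norm2 (A *\<^sub>v v) |v. v \<in> carrier_vec (dim_col A) \<and> vec_norm2 v \<le> 1} \<noteq> {}"
      by (auto intro!: exI[of _ "0\<^sub>v (dim_col A)"] simp: vec_norm2_def)
    fix a assume "a \<in> {vec_norm2 (A *\<^sub>v v) |v. v \<in> carrier_vec (dim_col A) \<and> vec_norm2 v \<le> 1}"
    then obtain v where v: "v \<in> carrier_vec n" "vec_norm2 v \<le> 1" "a = vec_norm2 (A *\<^sub>v v)"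
      using A by auto
    then have "a \<le> c * vec_norm2 v" using * by auto
    also have "\<dots> \<le> c * 1" using v c by (intro mult_left_mono)
    finally show "a \<le> c" by simp
  qed
qed

lemma mat_norm2_nonneg: "0 \<le> mat_norm2 A"
  unfolding mat_norm2_def
  by (rule order_trans[OF _ cSup_upper[OF _ bdd_above_mat_norm2, of "vec_norm2 (A *\<^sub>v 0\<^sub>v (dim_col A))"]])
    (auto intro!: exI[of _ "0\<^sub>v (dim_col A)"] simp: vec_norm2_def)

lemma mat_norm2_add_smult_le:
  assumes A: "A \<in> carrier_mat m n" and E: "E \<in> carrier_mat m n"
  shows "mat_norm2 (A + c \<cdot>\<^sub>m E) \<le> mat_norm2 A + cmod c * mat_norm2 E"
proof -
  have "vec_norm2 ((A + c \<cdot>\<^sub>m E) *\<^sub>v v) \<le> (mat_norm2 A + cmod c * mat_norm2 E) * vec_norm2 v"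
    if v: "v \<in> carrier_vec n" for v
  proof -
    have "(A + c \<cdot>\<^sub>m E) *\<^sub>v v = A *\<^sub>v v + c \<cdot>\<^sub>v (E *\<^sub>v v)"
      using A E v by (intro eq_vecI)
        (auto simp: scalar_prod_def sum_distrib_left sum.distrib algebra_simps)
    then have "vec_norm2 ((A + c \<cdot>\<^sub>m E) *\<^sub>v v) \<le> vec_norm2 (A *\<^sub>v v) + cmod c * vec_norm2 (E *\<^sub>v v)"
      using A E vec_norm2_triangle[of "A *\<^sub>v v" "c \<cdot>\<^sub>v (E *\<^sub>v v)"] by (simp add: vec_norm2_smult)
    also have "\<dots> \<le> mat_norm2 A * vec_norm2 v + cmod c * (mat_norm2 E * vec_norm2 v)"
      by (intro add_mono mult_left_mono vec_norm2_mult_mat_vec_le[OF A v] vec_norm2_mult_mat_vec_le[OF E v]) auto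
    finally show ?thesis by (simp add: algebra_simps)
  qed
  then show ?thesis
    using A E by (subst mat_norm2_le_iff[of _ m n]) (auto intro!: add_nonneg_nonneg mult_nonneg_nonneg mat_norm2_nonneg)
qed

lemma mat_norm2_scalar:
  assumes "0 < r"
  shows "mat_norm2 (d \<cdot>\<^sub>m 1\<^sub>m r) = cmod d"
proof -
  have act: "(d \<cdot>\<^sub>m 1\<^sub>m r) *\<^sub>v v = d \<cdot>\<^sub>v v" if "v \<in> carrier_vec r" for v
    using that by (intro eq_vecI) auto
  have le: "mat_norm2 (d \<cdot>\<^sub>m 1\<^sub>m r) \<le> c \<longleftrightarrow> (\<forall>v\<in>carrier_vec r. cmod d * vec_norm2 v \<le> c * vec_norm2 v)"
    if "0 \<le> c" for c
    using that by (subst mat_norm2_le_iff[of _ r r]) (auto simp: act vec_norm2_smult)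
  define u :: "complex vec" where "u = unit_vec r 0"
  have u: "u \<in> carrier_vec r" by (simp add: u_def)
  have "u $ 0 = 1" using assms by (simp add: u_def)
  then have "u \<noteq> 0\<^sub>v r" using assms by auto
  then have "0 < vec_norm2 u"
    using vec_norm2_eq_0_iff[OF u] vec_norm2_nonneg[of u] by linarith
  moreover have "cmod d * vec_norm2 u \<le> mat_norm2 (d \<cdot>\<^sub>m 1\<^sub>m r) * vec_norm2 u"
    using le[OF mat_norm2_nonneg] u by blast
  ultimately have "cmod d \<le> mat_norm2 (d \<cdot>\<^sub>m 1\<^sub>m r)" by simp
  moreover have "mat_norm2 (d \<cdot>\<^sub>m 1\<^sub>m r) \<le> cmod d" by (subst le) auto
  ultimately show ?thesis by simp
qed

section \<open>Block-diagonal matrices\<close>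

lemma diag_block_mat_carrier:
  assumes "list_all2 (\<lambda>A r. A \<in> carrier_mat r r) As sizes"
  shows "diag_block_mat As \<in> carrier_mat (sum_list sizes) (sum_list sizes)"
  using assms by (induction rule: list_all2_induct) (auto simp: Let_def)

lemma diag_block_mat_add_smult:
  fixes As Es :: "'a :: comm_ring_1 mat list"
  assumes "list_all2 (\<lambda>A r. A \<in> carrier_mat r r) As sizes"
    and "list_all2 (\<lambda>A r. A \<in> carrier_mat r r) Es sizes"
  shows "diag_block_mat (map2 (\<lambda>A E. A + c \<cdot>\<^sub>m E) As Es) = diag_block_mat As + c \<cdot>\<^sub>m diag_block_mat Es"
  using assms
proof (induction sizes arbitrary: As Es rule: list.induct)
  case Nil
  then show ?case by (auto intro!: eq_matI)
next
  case (Cons r sizes)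
  obtain A As' E Es' where eq: "As = A # As'" "Es = E # Es'"
    and A: "A \<in> carrier_mat r r" and E: "E \<in> carrier_mat r r"
    and As': "list_all2 (\<lambda>A r. A \<in> carrier_mat r r) As' sizes"
    and Es': "list_all2 (\<lambda>A r. A \<in> carrier_mat r r) Es' sizes"
    using Cons.prems by (auto simp: list_all2_Cons2)
  note D = diag_block_mat_carrier[OF As'] diag_block_mat_carrier[OF Es']
  show ?case
    unfolding eq by (rule eq_matI) (use A E D in \<open>auto simp: Let_def Cons.IH[OF As' Es']\<close>)
qed

lemma vec_block_append:
  assumes "v \<in> carrier_vec r" and "w \<in> carrier_vec (sum_list sizes)"
  shows "vec_block (r # sizes) 0 (v @\<^sub>v w) = v"
    and "k < length sizes \<Longrightarrow> vec_block (r # sizes) (Suc k) (v @\<^sub>v w) = vec_block sizes k w"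
proof -
  show "vec_block (r # sizes) 0 (v @\<^sub>v w) = v"
    using assms by (intro eq_vecI) (auto simp: vec_block_def)
  assume k: "k < length sizes"
  have "sum_list (take k sizes) + sizes ! k \<le> sum_list sizes"
    using k by (metis id_take_nth_drop le_add1 sum_list.append sum_list.Cons add.assoc)
  then show "vec_block (r # sizes) (Suc k) (v @\<^sub>v w) = vec_block sizes k w"
    using assms by (intro eq_vecI) (auto simp: vec_block_def)
qed

lemma carrier_vec_append_cases:
  assumes "v \<in> carrier_vec (r + m)"
  obtains v1 v2 where "v1 \<in> carrier_vec r" "v2 \<in> carrier_vec m" "v = v1 @\<^sub>v v2"
  using assms vec_first_last_append[OF assms] by (metis vec_first_carrier vec_last_carrier)

lemma vec_block_carrier [simp]: "vec_block sizes k v \<in> carrier_vec (sizes ! k)"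
  by (simp add: vec_block_def)

lemma vec_block_diag_block_mat:
  assumes "list_all2 (\<lambda>A r. A \<in> carrier_mat r r) As sizes"
    and "v \<in> carrier_vec (sum_list sizes)" and "k < length sizes"
  shows "vec_block sizes k (diag_block_mat As *\<^sub>v v) = As ! k *\<^sub>v vec_block sizes k v"
  using assms
proof (induction sizes arbitrary: As v k rule: list.induct)
  case Nil
  then show ?case by simp
next
  case (Cons r sizes)
  obtain A As' where eq: "As = A # As'" and A: "A \<in> carrier_mat r r"
    and As': "list_all2 (\<lambda>A r. A \<in> carrier_mat r r) As' sizes"
    using Cons.prems by (auto simp: list_all2_Cons2)
  note D = diag_block_mat_carrier[OF As']
  obtain v1 v2 where v: "v1 \<in> carrier_vec r" "v2 \<in> carrier_vec (sum_list sizes)" "v = v1 @\<^sub>v v2"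
    using Cons.prems(2) by (auto elim: carrier_vec_append_cases)
  have mult: "diag_block_mat As *\<^sub>v v = A *\<^sub>v v1 @\<^sub>v diag_block_mat As' *\<^sub>v v2"
    using mult_mat_vec_split[OF A D v(1,2)] A D by (simp add: eq v(3) Let_def)
  have c: "A *\<^sub>v v1 \<in> carrier_vec r" "diag_block_mat As' *\<^sub>v v2 \<in> carrier_vec (sum_list sizes)"
    using A D v by auto
  show ?case
    unfolding mult using Cons.prems(3) Cons.IH[OF As' v(2)]
    by (cases k) (auto simp: eq vec_block_append[OF c] vec_block_append[OF v(1,2)] v(3))
qed

lemma cscalar_prod_eq_sum_blocks:
  fixes v w :: "complex vec"
  assumes "v \<in> carrier_vec (sum_list sizes)" and "w \<in> carrier_vec (sum_list sizes)"
  shows "v \<bullet>c w = (\<Sum>k<length sizes. vec_block sizes k v \<bullet>c vec_block sizes k w)"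
  using assms
proof (induction sizes arbitrary: v w)
  case Nil
  then show ?case by (simp add: scalar_prod_def)
next
  case (Cons r sizes)
  obtain v1 v2 where v: "v1 \<in> carrier_vec r" "v2 \<in> carrier_vec (sum_list sizes)" "v = v1 @\<^sub>v v2"
    using Cons.prems(1) by (auto elim: carrier_vec_append_cases)
  obtain w1 w2 where w: "w1 \<in> carrier_vec r" "w2 \<in> carrier_vec (sum_list sizes)" "w = w1 @\<^sub>v w2"
    using Cons.prems(2) by (auto elim: carrier_vec_append_cases)
  have "conjugate w = conjugate w1 @\<^sub>v conjugate w2"
    unfolding w(3) by (rule eq_vecI) auto
  then have "v \<bullet>c w = v1 \<bullet>c w1 + v2 \<bullet>c w2"
    unfolding v(3) using v w by (simp add: scalar_prod_append[of _ r _ "sum_list sizes"])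
  then show ?case
    by (simp add: sum.lessThan_Suc_shift v(3) w(3) vec_block_append[OF v(1,2)] vec_block_append[OF w(1,2)]
      Cons.IH[OF v(2) w(2)] del: sum.lessThan_Suc)
qed

lemma vec_norm2_sq_eq_sum_blocks:
  assumes "v \<in> carrier_vec (sum_list sizes)"
  shows "(vec_norm2 v)\<^sup>2 = (\<Sum>k<length sizes. (vec_norm2 (vec_block sizes k v))\<^sup>2)"
  using cscalar_prod_eq_sum_blocks[OF assms assms]
  unfolding cscalar_prod_self of_real_sum[symmetric] of_real_eq_iff .

text \<open>Extension by zero outside one block preserves the norm; it lets a block inherit a norm bound
  from the whole matrix.\<close>

lemma vec_block_supported:
  assumes "k < length sizes" and "u \<in> carrier_vec (sizes ! k)"
  shows "\<exists>v\<in>carrier_vec (sum_list sizes). vec_block sizes k v = u \<and> vec_norm2 v = vec_norm2 u"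
  using assms
proof (induction sizes arbitrary: k)
  case Nil
  then show ?case by simp
next
  case (Cons r sizes)
  have z: "vec_norm2 (0\<^sub>v m) = 0" for m by (simp add: vec_norm2_def)
  show ?case
  proof (cases k)
    case 0
    then have u: "u \<in> carrier_vec r" using Cons.prems by simp
    have "vec_norm2 (u @\<^sub>v 0\<^sub>v (sum_list sizes)) = vec_norm2 u"
      using vec_norm2_append_sq[of u "0\<^sub>v (sum_list sizes)"] by (simp add: z)
    then show ?thesis
      using u 0 by (intro bexI[of _ "u @\<^sub>v 0\<^sub>v (sum_list sizes)"]) (auto simp: vec_block_append[of u r])
  next
    case (Suc k')
    obtain v where v: "v \<in> carrier_vec (sum_list sizes)" "vec_block sizes k' v = u" "vec_norm2 v = vec_norm2 u"
      using Cons.IH[of k'] Cons.prems Suc by auto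
    have "vec_norm2 (0\<^sub>v r @\<^sub>v v) = vec_norm2 u"
      using vec_norm2_append_sq[of "0\<^sub>v r" v] v by (simp add: z)
    then show ?thesis
      using v Suc Cons.prems by (intro bexI[of _ "0\<^sub>v r @\<^sub>v v"]) (auto simp: vec_block_append[of "0\<^sub>v r" r])
  qed
qed

text \<open>The norm of a block-diagonal matrix is the maximum of the norms of its blocks, stated as an
  equivalence of upper bounds so that the empty list of blocks needs no convention for the maximum.
  One direction tests the matrix on vectors supported in a single block, the other adds up the
  squared norms of the blocks of a vector.\<close>

lemma mat_norm2_diag_block_mat_le_iff:
  assumes As: "list_all2 (\<lambda>A r. A \<in> carrier_mat r r) As sizes" and c: "0 \<le> c"
  shows "mat_norm2 (diag_block_mat As) \<le> c \<longleftrightarrow> (\<forall>k<length sizes. mat_norm2 (As ! k) \<le> c)"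
proof
  note D = diag_block_mat_carrier[OF As]
  have Ak: "As ! k \<in> carrier_mat (sizes ! k) (sizes ! k)" if "k < length sizes" for k
    using As that by (auto simp: list_all2_conv_all_nth)
  show "\<forall>k<length sizes. mat_norm2 (As ! k) \<le> c" if *: "mat_norm2 (diag_block_mat As) \<le> c"
  proof (intro allI impI)
    fix k assume k: "k < length sizes"
    have "vec_norm2 (As ! k *\<^sub>v u) \<le> c * vec_norm2 u" if u: "u \<in> carrier_vec (sizes ! k)" for u
    proof -
      obtain v where v: "v \<in> carrier_vec (sum_list sizes)" "vec_block sizes k v = u" "vec_norm2 v = vec_norm2 u"
        using vec_block_supported[OF k u] by blast
      define w where "w = diag_block_mat As *\<^sub>v v"
      have w: "w \<in> carrier_vec (sum_list sizes)" using D v by (simp add: w_def)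
      have "(vec_norm2 (As ! k *\<^sub>v u))\<^sup>2 = (vec_norm2 (vec_block sizes k w))\<^sup>2"
        by (simp add: w_def vec_block_diag_block_mat[OF As v(1) k] v(2))
      also have "\<dots> \<le> (vec_norm2 w)\<^sup>2"
        unfolding vec_norm2_sq_eq_sum_blocks[OF w] using k by (intro member_le_sum) auto
      finally have "vec_norm2 (As ! k *\<^sub>v u) \<le> vec_norm2 w"
        using power2_le_imp_le vec_norm2_nonneg by blast
      also have "\<dots> \<le> c * vec_norm2 v"
        using * mat_norm2_le_iff[OF D c] v(1) by (simp add: w_def)
      finally show ?thesis by (simp add: v(3))
    qed
    then show "mat_norm2 (As ! k) \<le> c" by (subst mat_norm2_le_iff[OF Ak[OF k] c]) auto
  qed
  show "mat_norm2 (diag_block_mat As) \<le> c" if *: "\<forall>k<length sizes. mat_norm2 (As ! k) \<le> c"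
  proof (subst mat_norm2_le_iff[OF D c], intro ballI)
    fix v :: "complex vec" assume v: "v \<in> carrier_vec (sum_list sizes)"
    define w where "w = diag_block_mat As *\<^sub>v v"
    have w: "w \<in> carrier_vec (sum_list sizes)" using D v by (simp add: w_def)
    have "(vec_norm2 w)\<^sup>2 \<le> (\<Sum>k<length sizes. (c * vec_norm2 (vec_block sizes k v))\<^sup>2)"
      unfolding vec_norm2_sq_eq_sum_blocks[OF w]
    proof (intro sum_mono power_mono)
      fix k assume "k \<in> {..<length sizes}"
      then have k: "k < length sizes" by simp
      show "vec_norm2 (vec_block sizes k w) \<le> c * vec_norm2 (vec_block sizes k v)"
        using * k mat_norm2_le_iff[OF Ak[OF k] c] by (simp add: w_def vec_block_diag_block_mat[OF As v k])
    qed simp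
    also have "\<dots> = (c * vec_norm2 v)\<^sup>2"
      by (simp add: power_mult_distrib vec_norm2_sq_eq_sum_blocks[OF v] sum_distrib_left)
    finally show "vec_norm2 (diag_block_mat As *\<^sub>v v) \<le> c * vec_norm2 v"
      unfolding w_def by (rule power2_le_imp_le) (simp add: c)
  qed
qed

lemma single_block_carrier:
  assumes "k < length sizes" and "E \<in> carrier_mat (sizes ! k) (sizes ! k)"
  shows "list_all2 (\<lambda>A r. A \<in> carrier_mat r r) ((map (\<lambda>r. 0\<^sub>m r r) sizes)[k := E]) sizes"
  using assms by (auto simp: list_all2_conv_all_nth nth_list_update)

lemma cscalar_prod_single_block:
  fixes x z :: "complex vec"
  assumes x: "x \<in> carrier_vec (sum_list sizes)" and z: "z \<in> carrier_vec (sum_list sizes)"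
    and k: "k < length sizes" and E: "E \<in> carrier_mat (sizes ! k) (sizes ! k)"
  shows "(diag_block_mat ((map (\<lambda>r. 0\<^sub>m r r) sizes)[k := E]) *\<^sub>v x) \<bullet>c z
    = (E *\<^sub>v vec_block sizes k x) \<bullet>c vec_block sizes k z"
proof -
  define Es where "Es = (map (\<lambda>r. 0\<^sub>m r r) sizes)[k := E]"
  have Es: "list_all2 (\<lambda>A r. A \<in> carrier_mat r r) Es sizes"
    unfolding Es_def by (rule single_block_carrier[OF k E])
  have w: "diag_block_mat Es *\<^sub>v x \<in> carrier_vec (sum_list sizes)"
    using diag_block_mat_carrier[OF Es] x by simp
  have "(diag_block_mat Es *\<^sub>v x) \<bullet>c z
      = (\<Sum>j<length sizes. (Es ! j *\<^sub>v vec_block sizes j x) \<bullet>c vec_block sizes j z)"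
    unfolding cscalar_prod_eq_sum_blocks[OF w z]
    by (intro sum.cong refl) (simp add: vec_block_diag_block_mat[OF Es x])
  also have "\<dots> = (\<Sum>j<length sizes. if j = k then (E *\<^sub>v vec_block sizes k x) \<bullet>c vec_block sizes k z else 0)"
  proof (intro sum.cong refl)
    fix j assume "j \<in> {..<length sizes}"
    then have j: "j < length sizes" by simp
    have "0\<^sub>m (sizes ! j) (sizes ! j) *\<^sub>v vec_block sizes j x = 0\<^sub>v (sizes ! j)"
      by (rule eq_vecI) (auto simp: vec_block_def)
    then show "(Es ! j *\<^sub>v vec_block sizes j x) \<bullet>c vec_block sizes j z
        = (if j = k then (E *\<^sub>v vec_block sizes k x) \<bullet>c vec_block sizes k z else 0)"
      using j by (auto simp: Es_def nth_list_update)
  qed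
  also have "\<dots> = (E *\<^sub>v vec_block sizes k x) \<bullet>c vec_block sizes k z"
    using k by (simp add: sum.delta)
  finally show ?thesis by (simp add: Es_def)
qed

lemma diag_block_mat_update:
  fixes As :: "'a :: comm_ring_1 mat list"
  assumes As: "list_all2 (\<lambda>A r. A \<in> carrier_mat r r) As sizes"
    and k: "k < length sizes" and E: "E \<in> carrier_mat (sizes ! k) (sizes ! k)"
  shows "diag_block_mat (As[k := As ! k + c \<cdot>\<^sub>m E])
    = diag_block_mat As + c \<cdot>\<^sub>m diag_block_mat ((map (\<lambda>r. 0\<^sub>m r r) sizes)[k := E])"
proof -
  define Es where "Es = (map (\<lambda>r. 0\<^sub>m r r) sizes)[k := E]"
  have Es: "list_all2 (\<lambda>A r. A \<in> carrier_mat r r) Es sizes"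
    unfolding Es_def by (rule single_block_carrier[OF k E])
  have len: "length As = length sizes" using As by (rule list_all2_lengthD)
  have "map2 (\<lambda>A E. A + c \<cdot>\<^sub>m E) As Es = As[k := As ! k + c \<cdot>\<^sub>m E]"
  proof (rule nth_equalityI)
    fix j assume "j < length (map2 (\<lambda>A E. A + c \<cdot>\<^sub>m E) As Es)"
    then have j: "j < length sizes" using len by simp
    then have "As ! j \<in> carrier_mat (sizes ! j) (sizes ! j)"
      using As by (simp add: list_all2_conv_all_nth)
    then have "As ! j + c \<cdot>\<^sub>m 0\<^sub>m (sizes ! j) (sizes ! j) = As ! j"
      by (intro eq_matI) auto
    then show "map2 (\<lambda>A E. A + c \<cdot>\<^sub>m E) As Es ! j = As[k := As ! k + c \<cdot>\<^sub>m E] ! j"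
      using j k len by (auto simp: Es_def nth_list_update)
  qed (simp add: len Es_def)
  then show ?thesis
    using diag_block_mat_add_smult[OF As Es, of c] by (simp add: Es_def)
qed

section \<open>First-order optimality\<close>

text \<open>With \<open>q\<close> the difference quotient, $|\mu(t)|^2 = |\zeta|^2 + t\,(t|q|^2 + 2\,\mathrm{Re}(\bar\zeta q))$,
  and the bracket tends to $2\,\mathrm{Re}(\bar\zeta c)$.\<close>

lemma eventually_cmod_less:
  assumes lim: "((\<lambda>t. (\<mu> t - \<zeta>) / complex_of_real t) \<longlongrightarrow> c) (at_right 0)"
    and c: "Re (cnj \<zeta> * c) < 0"
  shows "\<forall>\<^sub>F t in at_right 0. cmod (\<mu> t) < cmod \<zeta>"
proof -
  define q where "q t = (\<mu> t - \<zeta>) / complex_of_real t" for t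
  have "((\<lambda>t. t * (cmod (q t))\<^sup>2 + 2 * Re (cnj \<zeta> * q t))
      \<longlongrightarrow> 0 * (cmod c)\<^sup>2 + 2 * Re (cnj \<zeta> * c)) (at_right 0)"
    unfolding q_def by (intro tendsto_intros lim)
  then have "\<forall>\<^sub>F t in at_right 0. t * (cmod (q t))\<^sup>2 + 2 * Re (cnj \<zeta> * q t) < 0"
    by (rule order_tendstoD) (use c in simp)
  moreover have "\<forall>\<^sub>F t in at_right (0::real). 0 < t"
    by (simp add: eventually_at_filter)
  ultimately show ?thesis
  proof eventually_elim
    case (elim t)
    have "\<mu> t = \<zeta> + complex_of_real t * q t" using elim by (simp add: q_def)
    then have "(cmod (\<mu> t))\<^sup>2 = (cmod \<zeta>)\<^sup>2 + t * (t * (cmod (q t))\<^sup>2 + 2 * Re (cnj \<zeta> * q t))"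
      unfolding cmod_power2 by (simp add: power2_eq_square algebra_simps)
    also have "\<dots> < (cmod \<zeta>)\<^sup>2" using elim by (simp add: mult_pos_neg)
    finally show ?case by (rule power_less_imp_less_base) simp
  qed
qed

text \<open>The eigenvalue \<open>\<zeta>\<close> of $I - \varepsilon M D$ moves at first order by
  $c = -\varepsilon\, y^* M E x / (y^* x)$. The scaling $y^* x = s e^{-\mathbf{i}\theta}$ has the phase of
  $\bar\zeta$, so that $\bar\zeta c = -\varepsilon |\zeta|\, (M^* y)^* E x / s$, and the sign of
  the real part of $(M^* y)^* E x$ decides whether the modulus decreases.\<close>

lemma eigenvalue_descent:
  assumes M: "M \<in> carrier_mat n n" and D: "D \<in> carrier_mat n n" and E: "E \<in> carrier_mat n n"
    and \<epsilon>: "0 < \<epsilon>" and C: "C = 1\<^sub>m n - complex_of_real \<epsilon> \<cdot>\<^sub>m (M * D)"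
    and simple: "simple_eigenvalue C \<zeta>" and x: "eigenvector C x \<zeta>" and y: "left_eigenvector C y \<zeta>"
    and \<zeta>: "\<zeta> \<noteq> 0" "\<zeta> = complex_of_real (cmod \<zeta>) * exp (\<i> * complex_of_real \<theta>)"
    and s: "complex_of_real s = exp (\<i> * complex_of_real \<theta>) * (x \<bullet>c y)" "0 < s"
    and ascent: "0 < Re ((E *\<^sub>v x) \<bullet>c (mat_adjoint M *\<^sub>v y))" and \<rho>: "0 < \<rho>"
  shows "\<forall>\<^sub>F t in at_right 0. \<exists>\<mu>. dist \<mu> \<zeta> < \<rho> \<and> cmod \<mu> < cmod \<zeta> \<and>
    eigenvalue (1\<^sub>m n - complex_of_real \<epsilon> \<cdot>\<^sub>m (M * (D + complex_of_real t \<cdot>\<^sub>m E))) \<mu>"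
proof -
  define G where "G = (- complex_of_real \<epsilon>) \<cdot>\<^sub>m (M * E)"
  define h where "h = (E *\<^sub>v x) \<bullet>c (mat_adjoint M *\<^sub>v y)"
  define c where "c = ((G *\<^sub>v x) \<bullet>c y) / (x \<bullet>c y)"
  have Cc: "C \<in> carrier_mat n n" unfolding C using M D by (intro minus_carrier_mat) auto
  have Gc: "G \<in> carrier_mat n n" using M E by (simp add: G_def)
  have xc: "x \<in> carrier_vec n" using x Cc by (simp add: eigenvector_def)
  have yc: "y \<in> carrier_vec n" "y \<noteq> 0\<^sub>v n" using y Cc by (auto simp: left_eigenvector_def)
  have xy: "x \<bullet>c y \<noteq> 0" using s by auto
  have pert: "C + complex_of_real t \<cdot>\<^sub>m G
      = 1\<^sub>m n - complex_of_real \<epsilon> \<cdot>\<^sub>m (M * (D + complex_of_real t \<cdot>\<^sub>m E))" for t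
  proof -
    have "M * (D + complex_of_real t \<cdot>\<^sub>m E) = M * D + complex_of_real t \<cdot>\<^sub>m (M * E)"
      using M D E by (simp add: mult_add_distrib_mat[of _ n n] mult_smult_distrib[of _ n n])
    then show ?thesis
      unfolding C G_def using M D E by (intro eq_matI) (auto simp: algebra_simps)
  qed
  obtain \<mu> where ev: "\<And>t. eigenvalue (C + complex_of_real t \<cdot>\<^sub>m G) (\<mu> t)"
    and lim0: "((\<lambda>t. (\<mu> t - \<zeta>) / complex_of_real t) \<longlongrightarrow> c) (at 0)"
    using simple_eigenvalue_first_order[OF Cc Gc simple x yc left_eigenvector_cscalar_prod[OF Cc y] xy]
    unfolding c_def by blast
  have lim: "((\<lambda>t. (\<mu> t - \<zeta>) / complex_of_real t) \<longlongrightarrow> c) (at_right 0)"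
    using lim0 by (rule filterlim_mono) (auto intro: at_le)
  have "(G *\<^sub>v x) \<bullet>c y = - complex_of_real \<epsilon> * ((M *\<^sub>v (E *\<^sub>v x)) \<bullet>c y)"
    unfolding G_def using M E xc yc
    by (simp add: smult_mat_mult_vec[of _ n n] assoc_mult_mat_vec[of _ n n _ n] )
  also have "\<dots> = - complex_of_real \<epsilon> * h"
    unfolding h_def using M E xc yc by (subst cscalar_prod_adjoint[of _ n n]) auto
  finally have c_eq: "c = - complex_of_real \<epsilon> * h / (x \<bullet>c y)" by (simp add: c_def)
  have "cnj (exp (\<i> * complex_of_real \<theta>)) * exp (\<i> * complex_of_real \<theta>) = 1"
    using complex_norm_square[of "exp (\<i> * complex_of_real \<theta>)"] by (simp add: mult.commute)
  then have "cnj (exp (\<i> * complex_of_real \<theta>)) * complex_of_real s = x \<bullet>c y"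
    unfolding s(1) by (metis mult.assoc mult_1)
  moreover have "cnj \<zeta> = complex_of_real (cmod \<zeta>) * cnj (exp (\<i> * complex_of_real \<theta>))"
    by (subst \<zeta>(2)) simp
  ultimately have "cnj \<zeta> * complex_of_real s = complex_of_real (cmod \<zeta>) * (x \<bullet>c y)"
    by (simp add: mult.assoc)
  then have "cnj \<zeta> * c = complex_of_real (- \<epsilon> * cmod \<zeta> / s) * h"
    using s(2) xy by (simp add: c_eq field_simps)
  then have "Re (cnj \<zeta> * c) = - \<epsilon> * cmod \<zeta> / s * Re h"
    by (simp only: Re_complex_of_real times_complex.sel Im_complex_of_real)
  also have "\<dots> < 0"
    using \<epsilon> \<zeta>(1) s(2) ascent by (intro mult_neg_pos) (auto simp: h_def)
  finally have "\<forall>\<^sub>F t in at_right 0. cmod (\<mu> t) < cmod \<zeta>"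
    by (rule eventually_cmod_less[OF lim])
  moreover have "\<forall>\<^sub>F t in at_right 0. dist (\<mu> t) \<zeta> < \<rho>"
  proof -
    have pos: "\<forall>\<^sub>F t in at_right (0::real). 0 < t" by (simp add: eventually_at_filter)
    have "((\<lambda>t. \<zeta> + complex_of_real t * ((\<mu> t - \<zeta>) / complex_of_real t))
        \<longlongrightarrow> \<zeta> + complex_of_real 0 * c) (at_right 0)"
      by (intro tendsto_intros lim)
    moreover have "\<forall>\<^sub>F t in at_right 0. \<zeta> + complex_of_real t * ((\<mu> t - \<zeta>) / complex_of_real t) = \<mu> t"
      using pos by eventually_elim simp
    ultimately have "(\<mu> \<longlongrightarrow> \<zeta> + complex_of_real 0 * c) (at_right 0)"
      by (rule Lim_transform_eventually)
    then have "(\<mu> \<longlongrightarrow> \<zeta>) (at_right 0)" by simp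
    then show ?thesis using \<rho> by (rule tendstoD)
  qed
  ultimately show ?thesis
    by eventually_elim (use ev in \<open>auto simp flip: pert\<close>)
qed

lemma eigenvalue_one_minus:
  fixes X :: "complex mat"
  assumes X: "X \<in> carrier_mat n n" and ev: "eigenvalue (1\<^sub>m n - X) \<mu>"
  shows "1 - \<mu> \<in> spectrum X"
proof -
  obtain v where v: "v \<in> carrier_vec n" "v \<noteq> 0\<^sub>v n" "(1\<^sub>m n - X) *\<^sub>v v = \<mu> \<cdot>\<^sub>v v"
    using ev X by (auto simp: eigenvalue_def eigenvector_def)
  have eq: "v - X *\<^sub>v v = \<mu> \<cdot>\<^sub>v v"
    using v(3) X v(1) by (simp add: minus_mult_distrib_mat_vec[of _ n n])
  have "X *\<^sub>v v = (1 - \<mu>) \<cdot>\<^sub>v v"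
  proof (rule eq_vecI)
    fix i assume "i < dim_vec ((1 - \<mu>) \<cdot>\<^sub>v v)"
    then show "(X *\<^sub>v v) $ i = ((1 - \<mu>) \<cdot>\<^sub>v v) $ i"
      using arg_cong[OF eq, of "\<lambda>w. w $ i"] X v(1) by (simp add: algebra_simps)
  qed (use X v in auto)
  then show ?thesis using X v by (auto simp: spectrum_def eigenvalue_def eigenvector_def)
qed

text \<open>At a local minimum of the modulus no feasible direction can be a descent direction. Locality is
  measured in the complex plane, so the moving eigenvalue has to stay close to \<open>\<zeta>\<close>, which
  \<open>eigenvalue_descent\<close> provides with the parameter \<open>\<rho>\<close>.\<close>

lemma first_order_optimality:
  assumes M: "M \<in> carrier_mat n n" and D: "D \<in> carrier_mat n n" and E: "E \<in> carrier_mat n n"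
    and \<epsilon>: "0 < \<epsilon>" and C: "C = 1\<^sub>m n - complex_of_real \<epsilon> \<cdot>\<^sub>m (M * D)"
    and simple: "simple_eigenvalue C \<zeta>" and x: "eigenvector C x \<zeta>" and y: "left_eigenvector C y \<zeta>"
    and \<zeta>: "\<zeta> \<noteq> 0" "\<zeta> = complex_of_real (cmod \<zeta>) * exp (\<i> * complex_of_real \<theta>)"
    and s: "complex_of_real s = exp (\<i> * complex_of_real \<theta>) * (x \<bullet>c y)" "0 < s"
    and min: "locally_minimizes_modulus (Sigma_eps B \<epsilon> M) \<zeta>"
    and feasible: "\<forall>\<^sub>F t in at_right 0. D + complex_of_real t \<cdot>\<^sub>m E \<in> B
      \<and> mat_norm2 (D + complex_of_real t \<cdot>\<^sub>m E) \<le> 1"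
  shows "Re ((E *\<^sub>v x) \<bullet>c (mat_adjoint M *\<^sub>v y)) \<le> 0"
proof (rule ccontr)
  assume "\<not> ?thesis"
  then have ascent: "0 < Re ((E *\<^sub>v x) \<bullet>c (mat_adjoint M *\<^sub>v y))" by simp
  obtain \<rho> where \<rho>: "0 < \<rho>" "\<forall>\<sigma>\<in>Sigma_eps B \<epsilon> M. dist \<sigma> \<zeta> < \<rho> \<longrightarrow> cmod \<zeta> \<le> cmod \<sigma>"
    using min by (auto simp: locally_minimizes_modulus_def)
  have "\<forall>\<^sub>F t in at_right (0::real). False"
    using eigenvalue_descent[OF M D E \<epsilon> C simple x y \<zeta> s ascent \<rho>(1)] feasible
  proof eventually_elim
    case (elim t)
    define D' where "D' = D + complex_of_real t \<cdot>\<^sub>m E"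
    obtain \<mu> where \<mu>: "dist \<mu> \<zeta> < \<rho>" "cmod \<mu> < cmod \<zeta>"
      "eigenvalue (1\<^sub>m n - complex_of_real \<epsilon> \<cdot>\<^sub>m (M * D')) \<mu>"
      using elim by (auto simp: D'_def)
    have "1 - \<mu> \<in> spectrum (complex_of_real \<epsilon> \<cdot>\<^sub>m (M * D'))"
      using \<mu>(3) M D E by (intro eigenvalue_one_minus[of _ n]) (auto simp: D'_def)
    then have "1 - \<mu> \<in> Lambda_eps B \<epsilon> M"
      using elim(2) unfolding Lambda_eps_def D'_def by blast
    then have "\<mu> \<in> Sigma_eps B \<epsilon> M"
      unfolding Sigma_eps_def by (auto intro!: exI[of _ "1 - \<mu>"])
    then show False using \<rho>(2) \<mu>(1,2) by force
  qed
  then show False by simp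
qed

text \<open>A block of norm less than one can be moved for a short time in every direction without leaving
  the unit ball, as the norm of the whole matrix is the maximum over the blocks. Only membership in
  \<open>B\<close>, that is the structure of the block, restricts the direction.\<close>

lemma block_first_order_optimality:
  assumes n: "n = sum_list sizes" and M: "M \<in> carrier_mat n n"
    and As: "list_all2 (\<lambda>A r. A \<in> carrier_mat r r) As sizes"
    and \<epsilon>: "0 < \<epsilon>" and C: "C = 1\<^sub>m n - complex_of_real \<epsilon> \<cdot>\<^sub>m (M * diag_block_mat As)"
    and simple: "simple_eigenvalue C \<zeta>" and x: "eigenvector C x \<zeta>" and y: "left_eigenvector C y \<zeta>"
    and \<zeta>: "\<zeta> \<noteq> 0" "\<zeta> = complex_of_real (cmod \<zeta>) * exp (\<i> * complex_of_real \<theta>)"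
    and s: "complex_of_real s = exp (\<i> * complex_of_real \<theta>) * (x \<bullet>c y)" "0 < s"
    and min: "locally_minimizes_modulus (Sigma_eps B \<epsilon> M) \<zeta>"
    and norm: "mat_norm2 (diag_block_mat As) \<le> 1"
    and k: "k < length sizes" "mat_norm2 (As ! k) < 1"
    and E: "E \<in> carrier_mat (sizes ! k) (sizes ! k)"
    and B: "\<And>t. diag_block_mat (As[k := As ! k + complex_of_real t \<cdot>\<^sub>m E]) \<in> B"
  shows "Re ((E *\<^sub>v vec_block sizes k x) \<bullet>c vec_block sizes k (mat_adjoint M *\<^sub>v y)) \<le> 0"
proof -
  define D where "D = diag_block_mat As"
  define E' where "E' = diag_block_mat ((map (\<lambda>r. 0\<^sub>m r r) sizes)[k := E])"
  have D: "D \<in> carrier_mat n n" using diag_block_mat_carrier[OF As] by (simp add: D_def n)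
  have E': "E' \<in> carrier_mat n n"
    unfolding E'_def n by (intro diag_block_mat_carrier single_block_carrier k E)
  have C': "C = 1\<^sub>m n - complex_of_real \<epsilon> \<cdot>\<^sub>m (M * D)" by (simp add: C D_def)
  have Cc: "C \<in> carrier_mat n n" unfolding C' using M D by (intro minus_carrier_mat) auto
  have update: "diag_block_mat (As[k := As ! k + c \<cdot>\<^sub>m E]) = D + c \<cdot>\<^sub>m E'" for c
    unfolding D_def E'_def by (rule diag_block_mat_update[OF As k(1) E])
  have le1: "mat_norm2 (As ! j) \<le> 1" if "j < length sizes" for j
    using norm that mat_norm2_diag_block_mat_le_iff[OF As, of 1] by simp
  have Ak: "As ! k \<in> carrier_mat (sizes ! k) (sizes ! k)"
    using As k(1) by (simp add: list_all2_conv_all_nth)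
  have len: "length As = length sizes" using As by (rule list_all2_lengthD)
  have "((\<lambda>t. mat_norm2 (As ! k) + t * mat_norm2 E) \<longlongrightarrow> mat_norm2 (As ! k) + 0 * mat_norm2 E) (at_right 0)"
    by (intro tendsto_intros)
  then have "\<forall>\<^sub>F t in at_right 0. mat_norm2 (As ! k) + t * mat_norm2 E < 1"
    by (rule order_tendstoD) (use k in simp)
  moreover have "\<forall>\<^sub>F t in at_right (0::real). 0 < t"
    by (simp add: eventually_at_filter)
  ultimately have "\<forall>\<^sub>F t in at_right 0. D + complex_of_real t \<cdot>\<^sub>m E' \<in> B
      \<and> mat_norm2 (D + complex_of_real t \<cdot>\<^sub>m E') \<le> 1"
  proof eventually_elim
    case (elim t)
    define As' where "As' = As[k := As ! k + complex_of_real t \<cdot>\<^sub>m E]"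
    have As': "list_all2 (\<lambda>A r. A \<in> carrier_mat r r) As' sizes"
      using As Ak E k by (auto simp: As'_def list_all2_conv_all_nth nth_list_update)
    have "mat_norm2 (As ! k + complex_of_real t \<cdot>\<^sub>m E) \<le> 1"
      using mat_norm2_add_smult_le[OF Ak E, of "complex_of_real t"] elim by simp
    then have "mat_norm2 (diag_block_mat As') \<le> 1"
      using le1 len k by (subst mat_norm2_diag_block_mat_le_iff[OF As']) (auto simp: As'_def nth_list_update)
    then show ?case using B[of t] unfolding update[symmetric] As'_def by simp
  qed
  then have "Re ((E' *\<^sub>v x) \<bullet>c (mat_adjoint M *\<^sub>v y)) \<le> 0"
    by (rule first_order_optimality[OF M D E' \<epsilon> C' simple x y \<zeta> s min])
  moreover have "x \<in> carrier_vec n" using x Cc by (simp add: eigenvector_def)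
  moreover have "mat_adjoint M *\<^sub>v y \<in> carrier_vec n"
    using M by (intro carrier_vecI) (simp add: mat_adjoint_def)
  ultimately show ?thesis
    using cscalar_prod_single_block[OF _ _ k(1) E, of x "mat_adjoint M *\<^sub>v y"] by (simp add: E'_def n)
qed

section \<open>Unit norm of all blocks\<close>

lemma block_data_blocks:
  assumes "block_data S' rs ms ds Ds"
  shows "list_all2 (\<lambda>A r. A \<in> carrier_mat r r) (map2 (\<lambda>r d. d \<cdot>\<^sub>m 1\<^sub>m r) rs ds @ Ds) (rs @ ms)"
  using assms unfolding block_data_def
  by (intro list_all2_appendI) (auto simp: list_all2_conv_all_nth)

text \<open>The rank-one matrix $z x^*$ is the direction used for a full block: paired with $z$, its value
  at $x$ gives $\|x\|^2 \|z\|^2$.\<close>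

lemma outer_product_mult_vec:
  fixes x z :: "complex vec"
  assumes x: "x \<in> carrier_vec m" and z: "z \<in> carrier_vec m"
  shows "mat m m (\<lambda>(i, j). z $ i * cnj (x $ j)) *\<^sub>v x = (x \<bullet>c x) \<cdot>\<^sub>v z"
  using assms
  by (intro eq_vecI) (auto simp: scalar_prod_def sum_distrib_right sum_distrib_left mult_ac)

theorem theorem4p2:
  fixes n S S' F :: nat and rs ms :: "nat list"
    and M \<Delta>opt C :: "complex mat"
    and \<delta> :: "complex list" and \<Delta> :: "complex mat list"
    and \<epsilon> \<theta> s :: real and \<zeta> :: complex and x y z :: "complex vec"
    and B :: "complex mat set"
    and xb zb :: "nat \<Rightarrow> complex vec"
  assumes "S' \<le> S" and "length rs = S" and "length ms = F"
    and "\<forall>r\<in>set rs. 0 < r" and "\<forall>m\<in>set ms. 0 < m"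
    and "sum_list rs + sum_list ms = n"
    and B: "B = perturbations S' rs ms"
    and "M \<in> carrier_mat n n" and "0 < \<epsilon>"
    and "block_data S' rs ms \<delta> \<Delta>"
    and \<Delta>opt: "\<Delta>opt = block_diag rs \<delta> \<Delta>" and "mat_norm2 \<Delta>opt = 1"
    and "local_extremizer B \<epsilon> M \<Delta>opt"
    and C: "C = 1\<^sub>m n - complex_of_real \<epsilon> \<cdot>\<^sub>m (M * \<Delta>opt)"
    and "smallest_eigenvalue C \<zeta>" and "simple_eigenvalue C \<zeta>"
    and "locally_minimizes_modulus (Sigma_eps B \<epsilon> M) \<zeta>"
    and "\<zeta> \<noteq> 0" and "\<zeta> = complex_of_real (cmod \<zeta>) * exp (\<i> * complex_of_real \<theta>)"
    and "eigenvector C x \<zeta>" and "left_eigenvector C y \<zeta>"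
    and "complex_of_real s = exp (\<i> * complex_of_real \<theta>) * (x \<bullet>c y)" and "0 < s"
    and z: "z = mat_adjoint M *\<^sub>v y"
    and xb: "\<And>k. xb k = vec_block (rs @ ms) k x"
    and zb: "\<And>k. zb k = vec_block (rs @ ms) k z"
    and "\<forall>k<S'. xb k \<bullet>c zb k \<noteq> 0"
    and "\<forall>k<S. S' \<le> k \<longrightarrow> Re (xb k \<bullet>c zb k) \<noteq> 0"
    and "\<forall>h<F. vec_norm2 (zb (S + h)) * vec_norm2 (xb (S + h)) \<noteq> 0"
  shows "(\<forall>k<S. cmod (\<delta> ! k) = 1) \<and> (\<forall>h<F. mat_norm2 (\<Delta> ! h) = 1)"
proof -
  define sizes where "sizes = rs @ ms"
  define blocks where "blocks ds Ds = map2 (\<lambda>r d. d \<cdot>\<^sub>m 1\<^sub>m r) rs ds @ Ds"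
    for ds :: "complex list" and Ds :: "complex mat list"
  define As where "As = blocks \<delta> \<Delta>"
  have data: "length \<delta> = S" "length \<Delta> = F" "\<And>k. k < S \<Longrightarrow> S' \<le> k \<Longrightarrow> \<delta> ! k \<in> \<real>"
    "\<And>h. h < F \<Longrightarrow> \<Delta> ! h \<in> carrier_mat (ms ! h) (ms ! h)"
    using assms(2,3,10) by (auto simp: block_data_def)
  have As: "list_all2 (\<lambda>A r. A \<in> carrier_mat r r) As sizes"
    unfolding As_def blocks_def sizes_def by (rule block_data_blocks) fact
  have D: "\<Delta>opt = diag_block_mat As" by (simp add: \<Delta>opt block_diag_def As_def blocks_def)
  have len: "length sizes = S + F" using assms(2,3) by (simp add: sizes_def)
  have scalar: "As ! k = \<delta> ! k \<cdot>\<^sub>m 1\<^sub>m (rs ! k)" if "k < S" for k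
    using that data(1) assms(2) by (simp add: As_def blocks_def nth_append)
  have full: "As ! (S + h) = \<Delta> ! h" if "h < F" for h
    using that data(1) assms(2) by (simp add: As_def blocks_def nth_append)
  have norm_scalar: "mat_norm2 (As ! k) = cmod (\<delta> ! k)" if "k < S" for k
    using that assms(2,4) by (simp add: scalar mat_norm2_scalar)
  have le1: "mat_norm2 (As ! k) \<le> 1" if "k < S + F" for k
    using assms(12) that mat_norm2_diag_block_mat_le_iff[OF As, of 1] by (simp add: D len)
  have n: "n = sum_list sizes" using assms(6) by (simp add: sizes_def)
  have norm: "mat_norm2 (diag_block_mat As) \<le> 1" using assms(12) by (simp add: D)
  have opt: "Re ((E *\<^sub>v xb k) \<bullet>c zb k) \<le> 0"
    if "k < S + F" "mat_norm2 (As ! k) < 1" "E \<in> carrier_mat (sizes ! k) (sizes ! k)"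
      "\<And>t. diag_block_mat (As[k := As ! k + complex_of_real t \<cdot>\<^sub>m E]) \<in> B" for k E
    unfolding xb zb z sizes_def[symmetric]
    using that(1)
    by (intro block_first_order_optimality[OF n assms(8) As assms(9) C[unfolded D]
          assms(16,20,21,18,19,22,23,17) norm _ that(2,3,4)]) (simp add: len)
  have scalar_unit: "cmod (\<delta> ! k) = 1" if k: "k < S" for k
  proof (rule ccontr)
    assume "cmod (\<delta> ! k) \<noteq> 1"
    then have lt: "mat_norm2 (As ! k) < 1"
      using le1[of k] k by (simp add: norm_scalar)
    define p where "p = xb k \<bullet>c zb k"
    \<comment> \<open>The direction is \<open>cnj p\<close> for a complex parameter and \<open>Re p\<close> for a real one; then the real
      part of \<open>e * p\<close> is the square of \<open>cmod p\<close> or of \<open>Re p\<close>.\<close>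
    obtain e where e: "0 < Re (e * p)" "S' \<le> k \<Longrightarrow> e \<in> \<real>"
    proof (cases "S' \<le> k")
      case True
      then have "Re p \<noteq> 0" using assms(28) k by (simp add: p_def)
      then show ?thesis by (intro that[of "complex_of_real (Re p)"]) (auto simp: zero_less_mult_iff)
    next
      case False
      then have "p \<noteq> 0" using assms(27) by (simp add: p_def)
      then have "0 < Re (cnj p * p)" by (simp add: complex_neq_0 power2_eq_square)
      then show ?thesis using False by (intro that[of "cnj p"]) auto
    qed
    have size: "sizes ! k = rs ! k" using k assms(2) by (simp add: sizes_def nth_append)
    have "diag_block_mat (As[k := As ! k + complex_of_real t \<cdot>\<^sub>m (e \<cdot>\<^sub>m 1\<^sub>m (rs ! k))]) \<in> B" for t
    proof -
      define ds where "ds = \<delta>[k := \<delta> ! k + complex_of_real t * e]"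
      have block: "As ! k + complex_of_real t \<cdot>\<^sub>m (e \<cdot>\<^sub>m 1\<^sub>m (rs ! k)) = ds ! k \<cdot>\<^sub>m 1\<^sub>m (rs ! k)"
        using k data(1) by (intro eq_matI) (auto simp: scalar ds_def algebra_simps)
      have "As[k := As ! k + complex_of_real t \<cdot>\<^sub>m (e \<cdot>\<^sub>m 1\<^sub>m (rs ! k))] = blocks ds \<Delta>"
        unfolding block
        using k data(1) assms(2)
        by (intro nth_equalityI)
          (auto simp: As_def blocks_def ds_def nth_append nth_list_update list_update_append)
      moreover have "block_data S' rs ms ds \<Delta>"
        using assms(2,3,10) e(2) data(1,3) k
        by (auto simp: block_data_def ds_def nth_list_update intro!: Reals_add Reals_mult)
      ultimately show ?thesis
        unfolding B perturbations_def by (auto simp: block_diag_def blocks_def)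
    qed
    then have "Re (((e \<cdot>\<^sub>m 1\<^sub>m (rs ! k)) *\<^sub>v xb k) \<bullet>c zb k) \<le> 0"
      using k lt by (intro opt) (simp_all add: size)
    moreover have "(e \<cdot>\<^sub>m 1\<^sub>m (rs ! k)) *\<^sub>v xb k = e \<cdot>\<^sub>v xb k"
      by (subst smult_mat_mult_vec[of _ "rs ! k" "rs ! k"])
        (auto simp: xb size[symmetric] sizes_def)
    moreover have "xb k \<in> carrier_vec (rs ! k)" "zb k \<in> carrier_vec (rs ! k)"
      unfolding xb zb size[symmetric] sizes_def by simp_all
    then have "(e \<cdot>\<^sub>v xb k) \<bullet>c zb k = e * p"
      by (simp add: p_def)
    ultimately show False using e(1) by simp
  qed
  have full_unit: "mat_norm2 (\<Delta> ! h) = 1" if h: "h < F" for h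
  proof (rule ccontr)
    assume "mat_norm2 (\<Delta> ! h) \<noteq> 1"
    then have lt: "mat_norm2 (As ! (S + h)) < 1"
      using le1[of "S + h"] h by (simp add: full)
    define m where "m = ms ! h"
    have size: "sizes ! (S + h) = m" using assms(2) by (simp add: sizes_def nth_append m_def)
    have carrier: "xb (S + h) \<in> carrier_vec m" "zb (S + h) \<in> carrier_vec m"
      unfolding xb zb size[symmetric] sizes_def by simp_all
    \<comment> \<open>The rank-one direction $z_{S+h}\, x_{S+h}^*$, along which the derivative is
      $\|x_{S+h}\|^2 \|z_{S+h}\|^2$.\<close>
    define E where "E = mat m m (\<lambda>(i, j). zb (S + h) $ i * cnj (xb (S + h) $ j))"
    have E: "E \<in> carrier_mat m m" by (simp add: E_def)
    have "diag_block_mat (As[S + h := As ! (S + h) + complex_of_real t \<cdot>\<^sub>m E]) \<in> B" for t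
    proof -
      define Ds where "Ds = \<Delta>[h := \<Delta> ! h + complex_of_real t \<cdot>\<^sub>m E]"
      have "As[S + h := As ! (S + h) + complex_of_real t \<cdot>\<^sub>m E] = blocks \<delta> Ds"
        using h data(1) assms(2) by (simp add: full Ds_def) (simp add: As_def blocks_def list_update_append)
      moreover have "block_data S' rs ms \<delta> Ds"
        using assms(3,10) data(2,4) E h by (auto simp: block_data_def Ds_def nth_list_update m_def)
      ultimately show ?thesis
        unfolding B perturbations_def by (auto simp: block_diag_def blocks_def)
    qed
    then have "Re ((E *\<^sub>v xb (S + h)) \<bullet>c zb (S + h)) \<le> 0"
      using h lt E by (intro opt) (simp_all add: size)
    moreover have "E *\<^sub>v xb (S + h) = complex_of_real ((vec_norm2 (xb (S + h)))\<^sup>2) \<cdot>\<^sub>v zb (S + h)"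
      unfolding E_def outer_product_mult_vec[OF carrier] cscalar_prod_self ..
    then have "(E *\<^sub>v xb (S + h)) \<bullet>c zb (S + h)
        = complex_of_real ((vec_norm2 (xb (S + h)))\<^sup>2 * (vec_norm2 (zb (S + h)))\<^sup>2)"
      using carrier by (simp add: cscalar_prod_self)
    ultimately show False
      using assms(29) h by (simp add: mult_le_0_iff)
  qed
  show ?thesis using scalar_unit full_unit by simp
qed

end
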